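(* Every isosceles Heron triangle having two sides whose lengths are perfect squares is obtained, by scaling by a suitable positive rational factor, from the triangle with side lengths $\left(1,\,1,\,\dfrac{4k}{k^2+1}\right)$ for some positive rational number $k\neq 1$.
   Context: A Heron triangle is a (non-degenerate) triangle whose three side lengths and whose area are all positive integers. *)

theory Defs
  imports "HOL-Analysis.Analysis" "HOL-Library.Multiset"
begin

text \<open>Triangles are given by their three vertices in the Euclidean plane.\<close>

definition is_triangle :: "real^2 \<Rightarrow> real^2 \<Rightarrow> real^2 \<Rightarrow> bool" where
  "is_triangle A B C \<longleftrightarrow> \<not> collinear {A, B, C}"

text \<open>Side lengths are unordered but counted with multiplicity.\<close>

definition side_lengths :: "real^2 \<Rightarrow> real^2 \<Rightarrow> real^2 \<Rightarrow> real multiset" where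
  "side_lengths A B C = {# dist B C, dist C A, dist A B #}"

definition triangle_area :: "real^2 \<Rightarrow> real^2 \<Rightarrow> real^2 \<Rightarrow> real" where
  "triangle_area A B C = measure lebesgue (convex hull {A, B, C})"

definition pos_integer :: "real \<Rightarrow> bool" where
  "pos_integer x \<longleftrightarrow> x \<in> \<int> \<and> x > 0"

definition heron_triangle :: "real^2 \<Rightarrow> real^2 \<Rightarrow> real^2 \<Rightarrow> bool" where
  "heron_triangle A B C \<longleftrightarrow>
     is_triangle A B C \<and>
     (\<forall>s \<in># side_lengths A B C. pos_integer s) \<and>
     pos_integer (triangle_area A B C)"

definition isosceles :: "real^2 \<Rightarrow> real^2 \<Rightarrow> real^2 \<Rightarrow> bool" where
  "isosceles A B C \<longleftrightarrow> (\<exists>s. {# s, s #} \<subseteq># side_lengths A B C)"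

text \<open>Multiset inclusion makes the two sides distinct sides of the triangle, possibly
  of the same length.\<close>

definition has_two_square_sides :: "real^2 \<Rightarrow> real^2 \<Rightarrow> real^2 \<Rightarrow> bool" where
  "has_two_square_sides A B C \<longleftrightarrow>
     (\<exists>m n :: nat. {# real (m ^ 2), real (n ^ 2) #} \<subseteq># side_lengths A B C)"

end

theory Submission
  imports Defs
begin

text \<open>
  Let the sides be \<open>a, a, b\<close> and the area \<open>S\<close>. Half of the apex angle has cosine \<open>2 * S / (a * b)\<close>
  and sine \<open>b / (2 * a)\<close>, so these are the coordinates of a rational point on the unit circle.
  Its rational parameter \<open>k\<close>, the tangent of a quarter of the apex angle, satisfies
  \<open>b / (2 * a) = 2 * k / (1 + k\<^sup>2)\<close>, and scaling the triangle by \<open>1 / a\<close> turns its sides into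
  \<open>1, 1, 4 * k / (k\<^sup>2 + 1)\<close>. The value \<open>k = 1\<close> would give cosine \<open>0\<close>, hence area \<open>0\<close>.
\<close>

lemma rational_point_unit_circle:
  fixes x y :: "'a :: field_char_0"
  assumes circle: "x\<^sup>2 + y\<^sup>2 = 1" and "x \<noteq> -1" and "x \<in> \<rat>" "y \<in> \<rat>"
  obtains t where "t \<in> \<rat>" "x = (1 - t\<^sup>2) / (1 + t\<^sup>2)" "y = 2 * t / (1 + t\<^sup>2)"
proof
  define t where "t = y / (1 + x)"
  have nonzero: "1 + x \<noteq> 0"
    using \<open>x \<noteq> -1\<close> by (simp add: add_eq_0_iff)
  have y: "y = t * (1 + x)"
    using nonzero by (simp add: t_def)
  have "((1 + t\<^sup>2) * (1 + x)) * (1 + x) = 2 * (1 + x)"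
    using circle unfolding y by algebra
  then have param: "(1 + t\<^sup>2) * (1 + x) = 2"
    using mult_right_cancel[OF nonzero] by blast
  then have denom: "1 + t\<^sup>2 \<noteq> 0"
    by auto
  show "t \<in> \<rat>"
    unfolding t_def using assms(3,4) by (intro Rats_divide Rats_add Rats_1)
  show "x = (1 - t\<^sup>2) / (1 + t\<^sup>2)"
    using param denom by (simp add: eq_divide_eq algebra_simps)
  show "y = 2 * t / (1 + t\<^sup>2)"
    using param denom unfolding y by (simp add: eq_divide_eq mult_ac)
qed

lemma rational_isosceles_ratio:
  fixes a b S :: "'a :: linordered_field"
  assumes rat: "a \<in> \<rat>" "b \<in> \<rat>" "S \<in> \<rat>" and pos: "a > 0" "b > 0" "S > 0"
    and area: "16 * S\<^sup>2 = b\<^sup>2 * (4 * a\<^sup>2 - b\<^sup>2)"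
  obtains k where "k \<in> \<rat>" "k > 0" "k < 1" "b / a = 4 * k / (k\<^sup>2 + 1)"
proof -
  define x y where "x = 2 * S / (a * b)" and "y = b / (2 * a)"
  have "x > 0" "y > 0"
    using pos by (simp_all add: x_def y_def)
  have "x \<in> \<rat>" "y \<in> \<rat>"
    using rat unfolding x_def y_def by (auto intro!: Rats_divide Rats_mult)
  have "x\<^sup>2 + y\<^sup>2 = (16 * S\<^sup>2 + b\<^sup>2 * b\<^sup>2) / (4 * a\<^sup>2 * b\<^sup>2)"
    using pos by (simp add: x_def y_def field_simps power2_eq_square)
  also have "16 * S\<^sup>2 + b\<^sup>2 * b\<^sup>2 = 4 * a\<^sup>2 * b\<^sup>2"
    unfolding area by (simp add: algebra_simps)
  also have "4 * a\<^sup>2 * b\<^sup>2 / (4 * a\<^sup>2 * b\<^sup>2) = 1"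
    using pos by simp
  finally obtain k where "k \<in> \<rat>"
    and x: "x = (1 - k\<^sup>2) / (1 + k\<^sup>2)" and y: "y = 2 * k / (1 + k\<^sup>2)"
    using \<open>x > 0\<close> \<open>x \<in> \<rat>\<close> \<open>y \<in> \<rat>\<close> by (auto elim: rational_point_unit_circle)
  have denom: "1 + k\<^sup>2 > 0"
    by (simp add: add_pos_nonneg)
  have "k > 0"
    using \<open>y > 0\<close> denom by (simp add: y zero_less_divide_iff)
  have "k\<^sup>2 < 1"
    using \<open>x > 0\<close> denom by (simp add: x zero_less_divide_iff)
  then have "k < 1"
    using \<open>k > 0\<close> by (simp add: power_less_one_iff)
  have "b / a = 2 * y"
    by (simp add: y_def)
  also have "\<dots> = 4 * k / (k\<^sup>2 + 1)"
    by (simp add: y add.commute)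
  finally show thesis
    using that \<open>k \<in> \<rat>\<close> \<open>k > 0\<close> \<open>k < 1\<close> by blast
qed

lemma triangle_area_eq_measure_lborel:
  "triangle_area A B C = measure lborel (convex hull {A, B, C})"
proof -
  have "compact (convex hull {A, B, C})"
    by (intro compact_convex_hull finite_imp_compact) auto
  then show ?thesis
    unfolding triangle_area_def by (intro measure_completion) (auto dest: compact_imp_closed)
qed

lemma heron_side_lengths:
  fixes A B C :: "real^2"
  defines "p \<equiv> \<Sum>\<^sub># (side_lengths A B C)"
  shows "16 * (triangle_area A B C)\<^sup>2 = p * (\<Prod>d\<in>#side_lengths A B C. p - 2 * d)"
proof -
  define a b c where "a = dist B C" and "b = dist A C" and "c = dist A B"
  define s where "s = (a + b + c) / 2"
  have "a \<le> b + c" "b \<le> a + c" "c \<le> a + b"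
    using dist_triangle[of B C A] dist_triangle[of A C B] dist_triangle[of A B C]
    by (simp_all add: a_def b_def c_def dist_commute)
  moreover have "0 \<le> a" "0 \<le> b" "0 \<le> c"
    by (simp_all add: a_def b_def c_def)
  ultimately have "s * (s - a) * (s - b) * (s - c) \<ge> 0"
    by (intro mult_nonneg_nonneg) (simp_all add: s_def)
  then have "(triangle_area A B C)\<^sup>2 = s * (s - a) * (s - b) * (s - c)"
    by (simp add: triangle_area_eq_measure_lborel heron s_def a_def b_def c_def)
  moreover have "p = 2 * s"
    by (simp add: p_def side_lengths_def s_def a_def b_def c_def dist_commute)
  ultimately show ?thesis
    by (simp add: side_lengths_def a_def b_def c_def dist_commute algebra_simps)
qed

lemma heron_isosceles:
  assumes "side_lengths A B C = {#a, a, b#}"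
  shows "16 * (triangle_area A B C)\<^sup>2 = b\<^sup>2 * (4 * a\<^sup>2 - b\<^sup>2)"
  unfolding heron_side_lengths assms by (simp add: power2_eq_square algebra_simps)

lemma isosceles_iff_side_lengths:
  "isosceles A B C \<longleftrightarrow> (\<exists>a b. side_lengths A B C = {#a, a, b#})"
proof
  assume "isosceles A B C"
  then obtain a M where M: "side_lengths A B C = {#a, a#} + M"
    by (auto simp: isosceles_def mset_subset_eq_exists_conv)
  have "size (side_lengths A B C) = 3"
    by (simp add: side_lengths_def)
  then have "size M = 1"
    by (simp add: M)
  then obtain b where "M = {#b#}"
    using size_1_singleton_mset by blast
  then have "side_lengths A B C = {#a, a, b#}"
    using M by simp
  then show "\<exists>a b. side_lengths A B C = {#a, a, b#}"
    by blast
next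
  assume "\<exists>a b. side_lengths A B C = {#a, a, b#}"
  then obtain a b where "side_lengths A B C = {#a, a, b#}"
    by blast
  then have "{#a, a#} \<subseteq># side_lengths A B C"
    by simp
  then show "isosceles A B C"
    unfolding isosceles_def by blast
qed

lemma side_lengths_scaleR:
  "side_lengths (c *\<^sub>R A) (c *\<^sub>R B) (c *\<^sub>R C) = image_mset ((*) \<bar>c\<bar>) (side_lengths A B C)"
  by (simp add: side_lengths_def dist_norm flip: scaleR_diff_right)

lemma is_triangle_scaleR:
  assumes "c \<noteq> 0"
  shows "is_triangle (c *\<^sub>R A) (c *\<^sub>R B) (c *\<^sub>R C) \<longleftrightarrow> is_triangle A B C"
  using assms
  by (simp add: is_triangle_def collinear_3 collinear_scaleR_iff flip: scaleR_diff_right)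

lemma is_triangle_obtain_unscaled:
  assumes "is_triangle A B C" "c > 0"
  obtains P Q R where "is_triangle P Q R"
    "side_lengths P Q R = image_mset (\<lambda>d. d / c) (side_lengths A B C)"
    "A = c *\<^sub>R P" "B = c *\<^sub>R Q" "C = c *\<^sub>R R"
proof
  show "is_triangle (inverse c *\<^sub>R A) (inverse c *\<^sub>R B) (inverse c *\<^sub>R C)"
    using assms by (simp add: is_triangle_scaleR)
  show "side_lengths (inverse c *\<^sub>R A) (inverse c *\<^sub>R B) (inverse c *\<^sub>R C) =
      image_mset (\<lambda>d. d / c) (side_lengths A B C)"
    using assms(2) by (simp add: side_lengths_scaleR divide_inverse_commute)
qed (use assms(2) in simp_all)

theorem theorem1p5:
  fixes A B C :: "real^2"
  assumes "heron_triangle A B C"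
    and "isosceles A B C"
    and "has_two_square_sides A B C"
  shows "\<exists>k q :: real. k \<in> \<rat> \<and> k > 0 \<and> k \<noteq> 1 \<and> q \<in> \<rat> \<and> q > 0 \<and>
           (\<exists>P Q R :: real^2. is_triangle P Q R \<and>
              side_lengths P Q R = {# 1, 1, 4 * k / (k ^ 2 + 1) #} \<and>
              A = q *\<^sub>R P \<and> B = q *\<^sub>R Q \<and> C = q *\<^sub>R R)"
proof -
  obtain a b where sides: "side_lengths A B C = {#a, a, b#}"
    using assms(2) by (auto simp: isosceles_iff_side_lengths)
  have triangle: "is_triangle A B C"
    and pos: "a > 0" "b > 0" "triangle_area A B C > 0"
    and rat: "a \<in> \<rat>" "b \<in> \<rat>" "triangle_area A B C \<in> \<rat>"
    using assms(1) sides Ints_subset_Rats by (auto simp: heron_triangle_def pos_integer_def)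
  obtain k where k: "k \<in> \<rat>" "k > 0" "k < 1" and ratio: "b / a = 4 * k / (k\<^sup>2 + 1)"
    using rational_isosceles_ratio[OF rat pos heron_isosceles[OF sides]] .
  obtain P Q R where unscaled: "is_triangle P Q R" "A = a *\<^sub>R P" "B = a *\<^sub>R Q" "C = a *\<^sub>R R"
    and lengths: "side_lengths P Q R = image_mset (\<lambda>d. d / a) {#a, a, b#}"
    using is_triangle_obtain_unscaled[OF triangle pos(1), unfolded sides] by blast
  have "side_lengths P Q R = {#1, 1, 4 * k / (k\<^sup>2 + 1)#}"
    using pos(1) by (simp add: lengths flip: ratio)
  then show ?thesis
    using unscaled k rat(1) pos(1) by (intro exI[of _ k] exI[of _ a]) auto
qed

end
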